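(* Let $K$ be a real quadratic field and let $x\in\mathcal{O}_K$ satisfy $N(x)^2\le\Delta_K/3$. Let $\mathcal{J}=(x)$. If $\sigma(\mathcal{J})=\mathcal{J}$, then $x$ extends to at most one good basis of $\mathcal{O}_K$ up to equivalence; i.e. all good bases of $\mathcal{O}_K$ of the form $\{x,y\}$, $y\in\mathcal{O}_K$, are equivalent to one another.
   Context: $K=\mathbb{Q}(\sqrt D)\subset\mathbb{R}$, $D>1$ square-free; $\sigma$ is the nontrivial automorphism, $\bar x=\sigma(x)$, $N(x)=x\bar x$, $\Delta_K$ the discriminant. $\psi(x)=(x,\bar x)$, $\Lambda_K=\psi(\mathcal{O}_K)$, $T_\alpha=\mathrm{diag}(\alpha,1/\alpha)$. A basis $\{u,v\}$ of a planar lattice is minimal if $\|u\|=\|v\|$ and $|\langle u,v\rangle|\le\frac12\|u\|\|v\|$. A $\mathbb{Z}$-basis $\{x,y\}$ of $\mathcal{O}_K$ is good if for some $\alpha>0$, $T_\alpha\Lambda_K$ is well-rounded with minimal basis $\{T_\alpha\psi(x),T_\alpha\psi(y)\}$. Bases $\{x,y\},\{x',y'\}$ are equivalent if $F(x,y)=F(x',y')$, where $F(x,y)=N(x)^2+N(x)N(y)+N(y)^2-\Delta_K/4$. *)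

theory Defs
  imports
    "HOL-Analysis.Analysis"
    "HOL-Computational_Algebra.Squarefree"
begin

section \<open>Real quadratic fields\<close>

definition quad_field :: "int \<Rightarrow> real set" where
  "quad_field D = {of_rat a + of_rat b * sqrt (of_int D) | a b :: rat. True}"

text \<open>The nontrivial automorphism, in coordinates; the lemmas \<open>quad_conj_automorphism\<close> and
  \<open>quad_conj_unique\<close> below characterise it. It is meaningful on \<open>quad_field D\<close> only.\<close>

definition quad_conj :: "int \<Rightarrow> real \<Rightarrow> real" where
  "quad_conj D z = (THE w. \<exists>a b :: rat.
     z = of_rat a + of_rat b * sqrt (of_int D) \<and> w = of_rat a - of_rat b * sqrt (of_int D))"

definition quad_norm :: "int \<Rightarrow> real \<Rightarrow> real" where
  "quad_norm D z = z * quad_conj D z"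

definition quad_ints :: "int \<Rightarrow> real set" where
  "quad_ints D = {z \<in> quad_field D. algebraic_int z}"

definition int_span2 :: "'a::real_vector \<Rightarrow> 'a \<Rightarrow> 'a set" where
  "int_span2 u v = {of_int m *\<^sub>R u + of_int n *\<^sub>R v | m n :: int. True}"

definition int_basis :: "int \<Rightarrow> real \<Rightarrow> real \<Rightarrow> bool" where
  "int_basis D x y \<longleftrightarrow>
     quad_ints D = int_span2 x y \<and>
     (\<forall>m n :: int. of_int m * x + of_int n * y = 0 \<longrightarrow> m = 0 \<and> n = 0)"

text \<open>The discriminant is the squared determinant of the two embeddings on any integral basis;
  independence of the basis is \<open>quad_disc_eq\<close> below.\<close>

definition quad_disc :: "int \<Rightarrow> real" where
  "quad_disc D = (THE d. \<exists>x y. int_basis D x y \<and> d = (x * quad_conj D y - y * quad_conj D x)\<^sup>2)"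

definition principal_ideal :: "int \<Rightarrow> real \<Rightarrow> real set" where
  "principal_ideal D x = {r * x | r. r \<in> quad_ints D}"


section \<open>Planar lattices\<close>

text \<open>The condition \<open>u \<noteq> v\<close> is needed because \<open>{u, v}\<close> is a set: it collapses for \<open>u = v\<close>.\<close>

definition lattice_basis :: "(real \<times> real) set \<Rightarrow> real \<times> real \<Rightarrow> real \<times> real \<Rightarrow> bool" where
  "lattice_basis L u v \<longleftrightarrow> u \<noteq> v \<and> independent {u, v} \<and> L = int_span2 u v"

definition minimal_basis :: "(real \<times> real) set \<Rightarrow> real \<times> real \<Rightarrow> real \<times> real \<Rightarrow> bool" where
  "minimal_basis L u v \<longleftrightarrow>
     lattice_basis L u v \<and> norm u = norm v \<and> \<bar>u \<bullet> v\<bar> \<le> 1 / 2 * norm u * norm v"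

definition minimal_vectors :: "(real \<times> real) set \<Rightarrow> (real \<times> real) set" where
  "minimal_vectors L = {v \<in> L - {0}. \<forall>w \<in> L - {0}. norm v \<le> norm w}"

definition well_rounded :: "(real \<times> real) set \<Rightarrow> bool" where
  "well_rounded L \<longleftrightarrow> span (minimal_vectors L) = UNIV"


section \<open>Good bases\<close>

definition psi :: "int \<Rightarrow> real \<Rightarrow> real \<times> real" where
  "psi D x = (x, quad_conj D x)"

definition quad_lattice :: "int \<Rightarrow> (real \<times> real) set" where
  "quad_lattice D = psi D ` quad_ints D"

definition diag_T :: "real \<Rightarrow> real \<times> real \<Rightarrow> real \<times> real" where
  "diag_T \<alpha> p = (\<alpha> * fst p, 1 / \<alpha> * snd p)"

definition good_basis :: "int \<Rightarrow> real \<Rightarrow> real \<Rightarrow> bool" where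
  "good_basis D x y \<longleftrightarrow>
     int_basis D x y \<and>
     (\<exists>\<alpha>>0. well_rounded (diag_T \<alpha> ` quad_lattice D) \<and>
        minimal_basis (diag_T \<alpha> ` quad_lattice D) (diag_T \<alpha> (psi D x)) (diag_T \<alpha> (psi D y)))"

definition basis_form :: "int \<Rightarrow> real \<Rightarrow> real \<Rightarrow> real" where
  "basis_form D x y =
     (quad_norm D x)\<^sup>2 + quad_norm D x * quad_norm D y + (quad_norm D y)\<^sup>2 - quad_disc D / 4"

definition equivalent_bases :: "int \<Rightarrow> real \<times> real \<Rightarrow> real \<times> real \<Rightarrow> bool" where
  "equivalent_bases D b b' \<longleftrightarrow> basis_form D (fst b) (snd b) = basis_form D (fst b') (snd b')"


section \<open>Well-definedness\<close>

lemma sqrt_squarefree_irrational: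
  fixes D :: int
  assumes "D > 1" "squarefree D"
  shows "sqrt (of_int D) \<notin> \<rat>"
proof
  assume "sqrt (of_int D) \<in> \<rat>"
  moreover have "algebraic_int (sqrt (of_int D))" by auto
  ultimately have "sqrt (of_int D) \<in> \<int>"
    using rational_algebraic_int_is_int by blast
  then obtain n :: int where n: "sqrt (of_int D) = of_int n" by (auto elim: Ints_cases)
  then have "(of_int n :: real)\<^sup>2 = of_int D" using assms by (simp flip: n)
  then have eq: "n\<^sup>2 = D" by (metis of_int_eq_iff of_int_power)
  have "n dvd 1" by (rule squarefreeD[OF assms(2)]) (simp add: eq)
  then have "n\<^sup>2 = 1" by (simp add: power2_eq_1_iff abs_if split: if_splits)
  with eq assms show False by simp
qed

lemma quad_coords_unique:
  fixes a b c d :: rat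
  assumes "D > 1" "squarefree D"
    and eq: "of_rat a + of_rat b * sqrt (of_int D) = of_rat c + of_rat d * sqrt (of_int D)"
  shows "a = c \<and> b = d"
proof -
  have "b = d"
  proof (rule ccontr)
    assume "b \<noteq> d"
    then have "of_rat (b - d) \<noteq> (0 :: real)" by simp
    moreover have "of_rat (b - d) * sqrt (of_int D) = (of_rat (c - a) :: real)"
      using eq by (simp add: of_rat_diff algebra_simps)
    ultimately have "sqrt (of_int D) = of_rat (c - a) / of_rat (b - d)"
      by (simp add: field_simps)
    then have "sqrt (of_int D) \<in> \<rat>" by (simp flip: of_rat_divide)
    then show False using sqrt_squarefree_irrational assms by blast
  qed
  then show ?thesis using eq by simp
qed

lemma quad_conj_coords:
  assumes "D > 1" "squarefree D"
  shows "quad_conj D (of_rat a + of_rat b * sqrt (of_int D)) = of_rat a - of_rat b * sqrt (of_int D)"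
  unfolding quad_conj_def
  using quad_coords_unique[OF assms] by (intro the_equality) blast+

lemma quad_fieldE:
  assumes "z \<in> quad_field D"
  obtains a b :: rat where "z = of_rat a + of_rat b * sqrt (of_int D)"
  using assms unfolding quad_field_def by blast

lemma quad_fieldI: "of_rat a + of_rat b * sqrt (of_int D) \<in> quad_field D"
  unfolding quad_field_def by blast

lemma quad_conj_add:
  assumes D: "D > 1" "squarefree D" and "z \<in> quad_field D" "w \<in> quad_field D"
  shows "quad_conj D (z + w) = quad_conj D z + quad_conj D w" and "z + w \<in> quad_field D"
proof -
  obtain a b where z: "z = of_rat a + of_rat b * sqrt (of_int D)" using assms quad_fieldE by blast
  obtain c d where w: "w = of_rat c + of_rat d * sqrt (of_int D)" using assms quad_fieldE by blast
  have zw: "z + w = of_rat (a + c) + of_rat (b + d) * sqrt (of_int D)"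
    by (simp add: z w of_rat_add algebra_simps)
  show "quad_conj D (z + w) = quad_conj D z + quad_conj D w"
    unfolding zw unfolding z w quad_conj_coords[OF D] by (simp add: of_rat_add algebra_simps)
  show "z + w \<in> quad_field D" unfolding zw by (rule quad_fieldI)
qed

lemma quad_conj_mult:
  assumes D: "D > 1" "squarefree D" and "z \<in> quad_field D" "w \<in> quad_field D"
  shows "quad_conj D (z * w) = quad_conj D z * quad_conj D w" and "z * w \<in> quad_field D"
proof -
  obtain a b where z: "z = of_rat a + of_rat b * sqrt (of_int D)" using assms quad_fieldE by blast
  obtain c d where w: "w = of_rat c + of_rat d * sqrt (of_int D)" using assms quad_fieldE by blast
  have sq: "sqrt (of_int D) * sqrt (of_int D) = (of_int D :: real)" using D by simp
  have sq': "sqrt (of_int D) * (sqrt (of_int D) * t) = of_int D * t" for t :: real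
    using sq by (metis mult.assoc)
  have zw: "z * w = of_rat (a * c + of_int D * b * d) + of_rat (a * d + b * c) * sqrt (of_int D)"
    using D by (simp add: z w of_rat_add of_rat_mult algebra_simps sq sq')
  show "quad_conj D (z * w) = quad_conj D z * quad_conj D w"
    unfolding zw unfolding z w quad_conj_coords[OF D]
    using D by (simp add: of_rat_add of_rat_mult algebra_simps sq sq')
  show "z * w \<in> quad_field D" unfolding zw by (rule quad_fieldI)
qed

lemma quad_conj_of_rat:
  assumes "D > 1" "squarefree D"
  shows "quad_conj D (of_rat a) = of_rat a"
  using quad_conj_coords[OF assms, of a 0] by simp

lemma quad_conj_sqrt:
  assumes "D > 1" "squarefree D"
  shows "quad_conj D (sqrt (of_int D)) = - sqrt (of_int D)"
  using quad_conj_coords[OF assms, of 0 1] by simp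

definition quad_automorphism :: "int \<Rightarrow> (real \<Rightarrow> real) \<Rightarrow> bool" where
  "quad_automorphism D s \<longleftrightarrow>
     bij_betw s (quad_field D) (quad_field D) \<and> s 1 = 1 \<and>
     (\<forall>z\<in>quad_field D. \<forall>w\<in>quad_field D. s (z + w) = s z + s w \<and> s (z * w) = s z * s w)"

lemma quad_conj_automorphism:
  assumes D: "D > 1" "squarefree D"
  shows "quad_automorphism D (quad_conj D)" and "\<exists>z\<in>quad_field D. quad_conj D z \<noteq> z"
proof -
  have inv: "quad_conj D z \<in> quad_field D \<and> quad_conj D (quad_conj D z) = z"
    if z: "z \<in> quad_field D" for z
  proof -
    obtain a b where z: "z = of_rat a + of_rat b * sqrt (of_int D)" using z quad_fieldE by blast
    have c: "quad_conj D z = of_rat a + of_rat (- b) * sqrt (of_int D)"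
      unfolding z quad_conj_coords[OF D] by (simp add: of_rat_minus)
    have "quad_conj D (quad_conj D z) = z"
      unfolding c quad_conj_coords[OF D] by (simp add: z of_rat_minus)
    then show ?thesis using quad_fieldI[of a "- b" D] c by simp
  qed
  have "bij_betw (quad_conj D) (quad_field D) (quad_field D)"
    by (rule bij_betw_byWitness[where f' = "quad_conj D"]) (use inv in auto)
  then show "quad_automorphism D (quad_conj D)"
    unfolding quad_automorphism_def
    using quad_conj_add[OF D] quad_conj_mult[OF D] quad_conj_of_rat[OF D, of 1] by simp
  have "sqrt (of_int D) \<in> quad_field D" using quad_fieldI[of 0 1 D] by simp
  moreover have "quad_conj D (sqrt (of_int D)) \<noteq> sqrt (of_int D)"
    using quad_conj_sqrt[OF D] D by simp
  ultimately show "\<exists>z\<in>quad_field D. quad_conj D z \<noteq> z" by blast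
qed

lemma quad_conj_unique:
  assumes D: "D > 1" "squarefree D" and s: "quad_automorphism D s"
    and nt: "\<exists>z\<in>quad_field D. s z \<noteq> z" and z: "z \<in> quad_field D"
  shows "s z = quad_conj D z"
proof -
  have K_rat: "of_rat a \<in> quad_field D" for a using quad_fieldI[of a 0 D] by simp
  have K_sqrt: "sqrt (of_int D) \<in> quad_field D" using quad_fieldI[of 0 1 D] by simp
  have add: "s (u + v) = s u + s v" and mult: "s (u * v) = s u * s v"
    if "u \<in> quad_field D" "v \<in> quad_field D" for u v
    using s that unfolding quad_automorphism_def by auto
  have s1: "s 1 = 1" using s unfolding quad_automorphism_def by simp
  have K0: "0 \<in> quad_field D" using K_rat[of 0] by simp
  have s0: "s 0 = 0" using add[OF K0 K0] by simp
  have K1: "1 \<in> quad_field D" using K_rat[of 1] by simp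
  have K_nat: "of_nat n \<in> quad_field D" for n using K_rat[of "of_nat n"] by simp
  have s_nat: "s (of_nat n) = of_nat n" for n
    by (induction n) (use s0 s1 add[OF K1 K_nat] in auto)
  have K_int: "of_int k \<in> quad_field D" for k using K_rat[of "of_int k"] by simp
  have s_int: "s (of_int k) = of_int k" for k
  proof (cases k)
    case (nonneg n)
    then show ?thesis using s_nat[of n] by simp
  next
    case (neg n)
    have "s (of_int k + of_nat (Suc n)) = s (of_int k) + s (of_nat (Suc n))"
      using add[OF K_int K_nat] .
    then show ?thesis using neg s0 s_nat[of "Suc n"] by simp
  qed
  have s_rat: "s (of_rat a) = of_rat a" for a
  proof (cases a)
    case (Fract p q)
    have q: "of_int q \<noteq> (0::real)" using Fract by simp
    have "a * of_int q = of_int p" using Fract by (simp add: Fract_of_int_quotient)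
    then have e: "of_rat a * of_int q = (of_int p :: real)"
      by (metis of_rat_mult of_rat_of_int_eq)
    have "s (of_rat a) * of_int q = of_int p"
      using mult[OF K_rat K_int, of a q] e s_int by simp
    then show ?thesis using e q by (metis mult_right_cancel)
  qed
  have sD: "s (of_rat a + of_rat b * sqrt (of_int D)) = of_rat a + of_rat b * s (sqrt (of_int D))"
    for a b
    using add[OF K_rat] mult[OF K_rat K_sqrt] s_rat quad_fieldI[of 0 b D] by simp
  have "s (sqrt (of_int D)) * s (sqrt (of_int D)) = s (of_int D)"
    using mult[OF K_sqrt K_sqrt] D by simp
  then have "(s (sqrt (of_int D)))\<^sup>2 = (sqrt (of_int D))\<^sup>2"
    using s_int D by (simp add: power2_eq_square)
  then have "s (sqrt (of_int D)) = sqrt (of_int D) \<or> s (sqrt (of_int D)) = - sqrt (of_int D)"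
    by (simp add: power2_eq_iff)
  moreover have "s (sqrt (of_int D)) \<noteq> sqrt (of_int D)"
    using nt sD by (metis quad_fieldE)
  ultimately have "s (sqrt (of_int D)) = - sqrt (of_int D)" by blast
  moreover obtain a b where "z = of_rat a + of_rat b * sqrt (of_int D)"
    using z quad_fieldE by blast
  ultimately show ?thesis using sD quad_conj_coords[OF D] by simp
qed

lemma quad_disc_eq:
  assumes D: "D > 1" "squarefree D" and xy: "int_basis D x y"
  shows "quad_disc D = (x * quad_conj D y - y * quad_conj D x)\<^sup>2"
  unfolding quad_disc_def
proof (rule the_equality)
  show "\<exists>x' y'. int_basis D x' y' \<and> (x * quad_conj D y - y * quad_conj D x)\<^sup>2
      = (x' * quad_conj D y' - y' * quad_conj D x')\<^sup>2"
    using xy by blast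
next
  fix d
  assume "\<exists>x' y'. int_basis D x' y' \<and> d = (x' * quad_conj D y' - y' * quad_conj D x')\<^sup>2"
  then obtain x' y' where b': "int_basis D x' y'"
    and d: "d = (x' * quad_conj D y' - y' * quad_conj D x')\<^sup>2" by blast
  have mem: "u \<in> quad_ints D \<and> v \<in> quad_ints D" if "int_basis D u v" for u v
  proof -
    have eq: "quad_ints D = int_span2 u v" using that unfolding int_basis_def by simp
    have "of_int 1 *\<^sub>R u + of_int 0 *\<^sub>R v \<in> int_span2 u v"
      "of_int 0 *\<^sub>R u + of_int 1 *\<^sub>R v \<in> int_span2 u v"
      unfolding int_span2_def by blast+
    then show ?thesis unfolding eq by simp
  qed
  have K: "w \<in> quad_field D" if "w \<in> quad_ints D" for w
    using that unfolding quad_ints_def by simp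
  have rep: "\<exists>m n :: int. w = of_int m * u + of_int n * v"
    if "int_basis D u v" "w \<in> quad_ints D" for u v w
    using that unfolding int_basis_def int_span2_def by auto
  obtain a b :: int where x': "x' = of_int a * x + of_int b * y" 
    using rep[OF xy] mem[OF b'] by blast
  obtain c e :: int where y': "y' = of_int c * x + of_int e * y" 
    using rep[OF xy] mem[OF b'] by blast
  obtain p q :: int where x: "x = of_int p * x' + of_int q * y'" 
    using rep[OF b'] mem[OF xy] by blast
  obtain r t :: int where y: "y = of_int r * x' + of_int t * y'" 
    using rep[OF b'] mem[OF xy] by blast
  have indep: "m = 0 \<and> n = 0" if "of_int m * x + of_int n * y = 0" for m n :: int
    using xy that unfolding int_basis_def by blast
  have "of_int (p * a + q * c - 1) * x + of_int (p * b + q * e) * y = 0"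
    using x unfolding x' y' by (simp add: algebra_simps)
  from indep[OF this] have 1: "p * a + q * c = 1" "p * b + q * e = 0" by auto
  have "of_int (r * a + t * c) * x + of_int (r * b + t * e - 1) * y = 0"
    using y unfolding x' y' by (simp add: algebra_simps)
  from indep[OF this] have 2: "r * a + t * c = 0" "r * b + t * e = 1" by auto
  have "(p * t - q * r) * (a * e - b * c)
      = (p * a + q * c) * (r * b + t * e) - (p * b + q * e) * (r * a + t * c)"
    by (simp add: algebra_simps)
  then have "(a * e - b * c) dvd 1" 
    using 1 2 by (metis diff_zero dvd_triv_right mult_1 mult_zero_left)
  then have "(a * e - b * c)\<^sup>2 = 1" by (simp add: power2_eq_1_iff abs_if split: if_splits)
  then have det: "(of_int (a * e - b * c) :: real)\<^sup>2 = 1" by (metis of_int_1 of_int_power)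
  have conj: "quad_conj D (of_int m * x + of_int n * y)
      = of_int m * quad_conj D x + of_int n * quad_conj D y" for m n :: int
  proof -
    have Z: "(of_int k :: real) \<in> quad_field D" "quad_conj D (of_int k) = of_int k" for k :: int
      using quad_fieldI[of "of_int k" 0 D] quad_conj_of_rat[OF D, of "of_int k"] by simp_all
    have "x \<in> quad_field D" "y \<in> quad_field D" using mem[OF xy] K by auto
    then show ?thesis
      by (simp add: Z quad_conj_add[OF D] quad_conj_mult[OF D])
  qed
  have "x' * quad_conj D y' - y' * quad_conj D x'
      = of_int (a * e - b * c) * (x * quad_conj D y - y * quad_conj D x)"
    unfolding x' y' conj by (simp add: algebra_simps)
  then show "d = (x * quad_conj D y - y * quad_conj D x)\<^sup>2"
    unfolding d by (simp add: power_mult_distrib det del: of_int_diff of_int_mult)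
qed

end

theory Submission
  imports Defs
begin

text \<open>Write \<open>c = y / x\<close>, \<open>W = (c - \<sigma> c)\<^sup>2\<close> and \<open>k = c + \<sigma> c\<close>. Since \<open>J\<close> is stable under
  \<open>\<sigma>\<close>, \<open>x \<sigma>(y) / \<sigma>(x)\<close> is an algebraic integer; expanding it in the basis \<open>{x, y}\<close> shows
  that \<open>k\<close> is an integer. Another extension \<open>y'\<close> has the form \<open>i x \<plusminus> y\<close>, so \<open>W\<close> and the parity
  of \<open>k\<close> depend on \<open>x\<close> only. The angle condition of a good basis turns into
  \<open>(\<bar>k\<bar> - 1)\<^sup>2 \<le> W - 3 \<le> (\<bar>k\<bar> + 1)\<^sup>2\<close>. Hence \<open>\<bar>k\<bar>\<close> lies in an interval of length 2, which
  determines it within its parity class except when both endpoints \<open>\<bar>k\<bar>\<close> and \<open>\<bar>k\<bar> + 2\<close> occur;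
  in that case \<open>N(y) + N(y') = - N(x)\<close>, and the form again takes the same value on both
  bases.\<close>

section \<open>Conjugation on the field and its integers; integral coordinates\<close>

lemma quad_conj_in_field:
  assumes D: "D > 1" "squarefree D" and z: "z \<in> quad_field D"
  shows "quad_conj D z \<in> quad_field D"
  using quad_conj_automorphism(1)[OF D] z
  unfolding quad_automorphism_def bij_betw_def by blast

lemma quad_conj_conj:
  assumes D: "D > 1" "squarefree D" and z: "z \<in> quad_field D"
  shows "quad_conj D (quad_conj D z) = z"
proof -
  obtain a b where z: "z = of_rat a + of_rat b * sqrt (of_int D)"
    using z quad_fieldE by blast
  have c: "quad_conj D z = of_rat a + of_rat (- b) * sqrt (of_int D)"
    unfolding z quad_conj_coords[OF D] by (simp add: of_rat_minus)
  show ?thesis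
    unfolding c quad_conj_coords[OF D] by (simp add: z of_rat_minus)
qed

lemma quad_conj_eq_0_iff:
  assumes D: "D > 1" "squarefree D" and z: "z \<in> quad_field D"
  shows "quad_conj D z = 0 \<longleftrightarrow> z = 0"
  using quad_conj_conj[OF D z] quad_conj_of_rat[OF D, of 0] by auto

lemma quad_conj_int_combination:
  fixes m n :: int
  assumes D: "D > 1" "squarefree D" and "x \<in> quad_field D" "y \<in> quad_field D"
  shows "quad_conj D (of_int m * x + of_int n * y)
    = of_int m * quad_conj D x + of_int n * quad_conj D y"
proof -
  have "(of_int k :: real) \<in> quad_field D" "quad_conj D (of_int k) = of_int k" for k :: int
    using quad_fieldI[of "of_int k" 0 D] quad_conj_of_rat[OF D, of "of_int k"] by simp_all
  then show ?thesis
    using assms by (simp add: quad_conj_add[OF D] quad_conj_mult[OF D])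
qed

lemma quad_ints_field: "z \<in> quad_ints D \<Longrightarrow> z \<in> quad_field D"
  unfolding quad_ints_def by simp

text \<open>Conjugation is a ring homomorphism on the field that fixes the integer coefficients of
  \<open>p\<close>. It therefore sends roots of \<open>p\<close> to roots of \<open>p\<close>, which
  makes the ring of integers stable under conjugation.\<close>

lemma quad_conj_poly:
  assumes D: "D > 1" "squarefree D" and z: "z \<in> quad_field D"
    and "\<forall>i. coeff p i \<in> \<int>"
  shows "poly p z \<in> quad_field D \<and> quad_conj D (poly p z) = poly p (quad_conj D z)"
  using assms(4)
proof (induction p)
  case 0
  show ?case using quad_fieldI[of 0 0 D] quad_conj_of_rat[OF D, of 0] by simp
next
  case (pCons a p)
  have "coeff (pCons a p) 0 \<in> \<int>" and p: "\<forall>i. coeff p i \<in> \<int>"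
    using pCons.prems by (blast, metis coeff_pCons_Suc)
  then obtain k :: int where a: "a = of_int k" by (auto elim: Ints_cases)
  have "a \<in> quad_field D" "quad_conj D a = a"
    using quad_fieldI[of "of_int k" 0 D] quad_conj_of_rat[OF D, of "of_int k"]
    by (simp_all add: a)
  then show ?case
    using pCons.IH[OF p] z by (simp add: quad_conj_add[OF D] quad_conj_mult[OF D])
qed

lemma quad_conj_in_ints:
  assumes D: "D > 1" "squarefree D" and z: "z \<in> quad_ints D"
  shows "quad_conj D z \<in> quad_ints D"
proof -
  have zK: "z \<in> quad_field D" using z by (rule quad_ints_field)
  obtain p where p: "lead_coeff p = 1" "\<forall>i. coeff p i \<in> \<int>" "poly p z = 0"
    using z unfolding quad_ints_def algebraic_int.simps by blast
  have "poly p (quad_conj D z) = 0"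
    using quad_conj_poly[OF D zK p(2)] p(3) quad_conj_of_rat[OF D, of 0] by simp
  then show ?thesis
    using p quad_conj_in_field[OF D zK] unfolding quad_ints_def algebraic_int.simps by blast
qed

lemma int_basis_coords:
  assumes "int_basis D x y" "z \<in> quad_ints D"
  obtains m n :: int where "z = of_int m * x + of_int n * y"
  using assms unfolding int_basis_def int_span2_def by auto

lemma int_basis_nonzero:
  assumes "int_basis D x y"
  shows "x \<noteq> 0"
proof
  assume "x = 0"
  then have "of_int 1 * x + of_int 0 * y = 0" by simp
  then show False using assms unfolding int_basis_def by (metis zero_neq_one)
qed

section \<open>From the geometry of a good basis to bounds on the trace\<close>

text \<open>The weights are the squared coordinates of the image of \<open>x\<close> under
  \<open>diag_T \<alpha>\<close>. The image of \<open>y\<close> has these coordinates multiplied by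
  \<open>c\<close> and \<open>d\<close>, so equal length and the angle bound become weighted
  conditions on \<open>c\<close> and \<open>d\<close> in which \<alpha> occurs only through the
  weights.\<close>

lemma good_basis_weights:
  assumes good: "good_basis D x y" and nz: "x \<noteq> 0" "quad_conj D x \<noteq> 0"
  defines "c \<equiv> y / x" and "d \<equiv> quad_conj D y / quad_conj D x"
  obtains p q :: real where "p > 0" "q > 0" "p + q = p * c\<^sup>2 + q * d\<^sup>2"
    "\<bar>p * c + q * d\<bar> \<le> (p + q) / 2" "c \<noteq> d"
proof -
  obtain \<alpha> where \<alpha>: "\<alpha> > 0" and
    mb: "minimal_basis (diag_T \<alpha> ` quad_lattice D) (diag_T \<alpha> (psi D x)) (diag_T \<alpha> (psi D y))"
    using good unfolding good_basis_def by blast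
  define s t where "s = \<alpha> * x" and "t = quad_conj D x / \<alpha>"
  have u: "diag_T \<alpha> (psi D x) = (s, t)" and v: "diag_T \<alpha> (psi D y) = (s * c, t * d)"
    using nz \<alpha> by (simp_all add: diag_T_def psi_def s_def t_def c_def d_def)
  have st: "s \<noteq> 0" "t \<noteq> 0" using nz \<alpha> by (simp_all add: s_def t_def)
  have ne: "(s, t) \<noteq> (s * c, t * d)" and ind: "independent {(s, t), (s * c, t * d)}"
    and norm_eq: "norm (s, t) = norm (s * c, t * d)"
    and angle: "\<bar>(s, t) \<bullet> (s * c, t * d)\<bar> \<le> 1 / 2 * norm (s, t) * norm (s * c, t * d)"
    using mb unfolding minimal_basis_def lattice_basis_def u v by auto
  have sq: "(norm (s, t))\<^sup>2 = s\<^sup>2 + t\<^sup>2" "(norm (s * c, t * d))\<^sup>2 = s\<^sup>2 * c\<^sup>2 + t\<^sup>2 * d\<^sup>2"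
    by (simp_all add: norm_Pair power_mult_distrib)
  have "s\<^sup>2 + t\<^sup>2 = s\<^sup>2 * c\<^sup>2 + t\<^sup>2 * d\<^sup>2" using sq norm_eq by simp
  moreover have "\<bar>s\<^sup>2 * c + t\<^sup>2 * d\<bar> \<le> (s\<^sup>2 + t\<^sup>2) / 2"
    using angle sq(1) norm_eq by (simp add: power2_eq_square algebra_simps)
  \<comment> \<open>Equal ratios would make the second basis vector a multiple of the first.\<close>
  moreover have "c \<noteq> d"
  proof
    assume "c = d"
    then have "(s * c, t * d) = c *\<^sub>R (s, t)" by simp
    then have "(s * c, t * d) \<in> span {(s, t)}" by (metis insertI1 span_base span_scale)
    then have "dependent (insert (s * c, t * d) {(s, t)})"
      using ne unfolding dependent_def
      by (intro bexI[of _ "(s * c, t * d)"]) (auto simp: insert_Diff_if)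
    with ind show False by (simp add: insert_commute)
  qed
  ultimately show ?thesis using that[of "s\<^sup>2" "t\<^sup>2"] st by simp
qed

text \<open>Both \<open>c\<close> and \<open>d\<close> are roots of t^2 - k t + c d. Averaging this
  equation with weights \<open>p\<close>, \<open>q\<close> gives 1 + c d = k \<mu>, where \<mu> is
  the weighted mean of \<open>c\<close> and \<open>d\<close> and the mean of their squares is 1. The
  angle bound is |\<mu>| \<le> 1/2, so |1 + c d| \<le> |k|/2; substituting 4 c d = k^2 - (c - d)^2
  and completing squares yields both bounds.\<close>

lemma weights_trace_bounds:
  fixes p q c d k :: real
  assumes pos: "p > 0" "q > 0" and eq: "p + q = p * c\<^sup>2 + q * d\<^sup>2"
    and angle: "\<bar>p * c + q * d\<bar> \<le> (p + q) / 2" and k: "k = c + d"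
  shows "(\<bar>k\<bar> - 1)\<^sup>2 \<le> (c - d)\<^sup>2 - 3" "(c - d)\<^sup>2 - 3 \<le> (\<bar>k\<bar> + 1)\<^sup>2"
proof -
  have "(p + q) * (1 + c * d) = (p * c + q * d) * k"
  proof -
    have "(p * c + q * d) * k = (p * c\<^sup>2 + q * d\<^sup>2) + (p + q) * (c * d)"
      by (simp add: k power2_eq_square algebra_simps)
    then show ?thesis using eq by (simp add: algebra_simps)
  qed
  then have "(p + q) * \<bar>1 + c * d\<bar> = \<bar>p * c + q * d\<bar> * \<bar>k\<bar>"
    using pos by (metis abs_mult abs_of_pos add_pos_pos)
  also have "\<dots> \<le> (p + q) / 2 * \<bar>k\<bar>" using angle by (rule mult_right_mono) simp
  also have "\<dots> = (p + q) * (\<bar>k\<bar> / 2)" by simp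
  finally have *: "\<bar>1 + c * d\<bar> \<le> \<bar>k\<bar> / 2" using pos by simp
  have "4 * (c * d) = \<bar>k\<bar>\<^sup>2 - (c - d)\<^sup>2" by (simp add: k power2_eq_square algebra_simps)
  then show "(\<bar>k\<bar> - 1)\<^sup>2 \<le> (c - d)\<^sup>2 - 3" "(c - d)\<^sup>2 - 3 \<le> (\<bar>k\<bar> + 1)\<^sup>2"
    using * unfolding power2_sum power2_diff[of "\<bar>k\<bar>" 1] by (auto simp: abs_if split: if_splits)
qed

section \<open>Parity and integrality of the trace\<close>

text \<open>If the absolute values a < b differ, parity gives b \<ge> a + 2, while comparison
  through \<open>V\<close> gives b - 1 \<le> a + 1. Hence b = a + 2 and V = (a + 1)^2, so a^2 + b^2
  = 2 (a + 1)^2 + 2.\<close>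

lemma int_same_parity_near:
  fixes k l :: int and V :: real
  assumes par: "even (k - l)"
    and k: "(\<bar>of_int k\<bar> - 1)\<^sup>2 \<le> V" "V \<le> (\<bar>of_int k\<bar> + 1)\<^sup>2"
    and l: "(\<bar>of_int l\<bar> - 1)\<^sup>2 \<le> V" "V \<le> (\<bar>of_int l\<bar> + 1)\<^sup>2"
  shows "k\<^sup>2 = l\<^sup>2 \<or> (of_int k)\<^sup>2 + (of_int l)\<^sup>2 = 2 * V + 2"
proof -
  have aux: "(of_int a)\<^sup>2 + (of_int b)\<^sup>2 = 2 * V + 2"
    if "0 \<le> a" "a < b" "even (a - b)" "V \<le> (of_int a + 1)\<^sup>2" "(of_int b - 1)\<^sup>2 \<le> V"
    for a b :: int
  proof -
    have "b \<noteq> a + 1" using that(3) by auto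
    then have "a + 1 \<le> b - 1" using that(2) by simp
    then have "(of_int a + 1 :: real) \<le> of_int b - 1" by linarith
    moreover have "(of_int b - 1 :: real) \<le> of_int a + 1"
    proof (rule power2_le_imp_le)
      show "(of_int b - 1 :: real)\<^sup>2 \<le> (of_int a + 1)\<^sup>2" using that(4,5) by linarith
      show "(0 :: real) \<le> of_int a + 1" using that(1) by simp
    qed
    ultimately have b: "(of_int b :: real) = of_int a + 2" by simp
    then have "V = (of_int a + 1)\<^sup>2" using that(4,5) by (simp add: add.commute)
    then show ?thesis unfolding b by (simp add: power2_eq_square algebra_simps)
  qed
  have "even (\<bar>k\<bar> - \<bar>l\<bar>)" "even (\<bar>l\<bar> - \<bar>k\<bar>)" using par by auto
  then consider "\<bar>k\<bar> = \<bar>l\<bar>" | "(of_int \<bar>k\<bar>)\<^sup>2 + (of_int \<bar>l\<bar>)\<^sup>2 = 2 * V + 2"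
    using aux[of "\<bar>k\<bar>" "\<bar>l\<bar>"] aux[of "\<bar>l\<bar>" "\<bar>k\<bar>"] k l by fastforce
  then show ?thesis by cases (simp_all add: abs_eq_iff, auto)
qed

text \<open>With \<open>c\<close>, \<open>d\<close> the two ratios, the integer z = d x has
  coordinates \<open>i\<close>, \<open>j\<close> in the basis, so d = i + j c; conjugation gives c =
  i + j d. Subtracting, (1 + j)(c - d) = 0, which forces j = -1 and c + d = i.\<close>

lemma trace_quotient_int:
  assumes D: "D > 1" "squarefree D" and basis: "int_basis D x y"
    and x: "x \<in> quad_ints D" and y: "y \<in> quad_ints D"
    and J: "quad_conj D ` principal_ideal D x = principal_ideal D x"
    and ne: "y / x \<noteq> quad_conj D y / quad_conj D x"
  obtains k :: int where "y / x + quad_conj D y / quad_conj D x = of_int k"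
proof -
  note field = quad_ints_field[of _ D]
  have x0: "x \<noteq> 0" and cx0: "quad_conj D x \<noteq> 0"
    using int_basis_nonzero[OF basis] quad_conj_eq_0_iff[OF D field[OF x]] by auto
  \<comment> \<open>Stability of the ideal enters here: this element is also the conjugate of some
    \<open>r * x\<close>, so its quotient by the conjugate of \<open>x\<close> is integral.\<close>
  have "x * quad_conj D y \<in> principal_ideal D x"
    using quad_conj_in_ints[OF D y] unfolding principal_ideal_def by (auto simp: mult.commute)
  then obtain r where r: "r \<in> quad_ints D" and "x * quad_conj D y = quad_conj D (r * x)"
    using J unfolding principal_ideal_def by blast
  then have xy: "x * quad_conj D y = quad_conj D r * quad_conj D x"
    using quad_conj_mult(1)[OF D field[OF r] field[OF x]] by simp
  define z where "z = quad_conj D r"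
  have z: "z \<in> quad_ints D" unfolding z_def by (rule quad_conj_in_ints[OF D r])
  obtain i j :: int where ij: "z = of_int i * x + of_int j * y"
    using int_basis_coords[OF basis z] .
  define c d where "c = y / x" and "d = quad_conj D y / quad_conj D x"
  have yc: "y = c * x" and yd: "quad_conj D y = d * quad_conj D x"
    using x0 cx0 by (simp_all add: c_def d_def)
  have "z = d * x" using xy cx0 by (simp add: z_def yd mult.commute)
  then have "d * x = (of_int i + of_int j * c) * x"
    using ij by (simp add: yc algebra_simps)
  then have d: "d = of_int i + of_int j * c" using x0 by simp
  have "quad_conj D z = of_int i * quad_conj D x + of_int j * quad_conj D y"
    unfolding ij by (rule quad_conj_int_combination[OF D field[OF x] field[OF y]])
  \<comment> \<open>Conjugating the relation \<open>xy\<close> exchanges the roles of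
    \<open>c\<close> and \<open>d\<close>.\<close>
  moreover have "quad_conj D x * y = quad_conj D z * x"
  proof -
    note zx = quad_conj_mult[OF D field[OF z] field[OF quad_conj_in_ints[OF D x]]]
    have "quad_conj D (x * quad_conj D y) = quad_conj D (z * quad_conj D x)"
      using xy by (simp add: z_def)
    then show ?thesis
      using zx quad_conj_mult[OF D field[OF x] field[OF quad_conj_in_ints[OF D y]]]
        quad_conj_conj[OF D field[OF x]] quad_conj_conj[OF D field[OF y]] by simp
  qed
  then have "quad_conj D z = c * quad_conj D x" using x0 by (simp add: yc mult.commute)
  ultimately have "c * quad_conj D x = (of_int i + of_int j * d) * quad_conj D x"
    unfolding yd by (simp add: algebra_simps)
  then have c: "c = of_int i + of_int j * d" using cx0 by simp
  have "(1 + of_int j) * (c - d) = 0" using c d by (simp add: algebra_simps)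
  then have "(of_int j :: real) = - 1" using ne by (simp add: c_def d_def)
  then have "c + d = of_int i" using c by simp
  then show ?thesis using that by (simp add: c_def d_def)
qed

section \<open>Comparison of two extensions of \<open>x\<close>\<close>

theorem theorem4p2:
  fixes D :: int and x :: real and J :: "real set"
  assumes "D > 1" and "squarefree D"
    and "x \<in> quad_ints D"
    and "(quad_norm D x)\<^sup>2 \<le> quad_disc D / 3"
    and "J = principal_ideal D x"
    and "quad_conj D ` J = J"
  shows "\<forall>y \<in> quad_ints D. \<forall>y' \<in> quad_ints D.
           good_basis D x y \<longrightarrow> good_basis D x y' \<longrightarrow> equivalent_bases D (x, y) (x, y')"
proof (intro ballI impI)
  fix y y'
  assume y: "y \<in> quad_ints D" and y': "y' \<in> quad_ints D"
    and good: "good_basis D x y" and good': "good_basis D x y'"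
  note D = assms(1,2) and x = assms(3)
  note field = quad_ints_field[of _ D]
  have J: "quad_conj D ` principal_ideal D x = principal_ideal D x" using assms(5,6) by simp
  have basis: "int_basis D x y" and basis': "int_basis D x y'"
    using good good' unfolding good_basis_def by auto
  have x0: "x \<noteq> 0" and cx0: "quad_conj D x \<noteq> 0"
    using int_basis_nonzero[OF basis] quad_conj_eq_0_iff[OF D field[OF x]] by auto
  define n c d c' d' where "n = quad_norm D x" and "c = y / x"
    and "d = quad_conj D y / quad_conj D x" and "c' = y' / x"
    and "d' = quad_conj D y' / quad_conj D x"
  have n0: "n \<noteq> 0" using x0 cx0 by (simp add: n_def quad_norm_def)
  have eqs: "y = c * x" "quad_conj D y = d * quad_conj D x"
    "y' = c' * x" "quad_conj D y' = d' * quad_conj D x"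
    using x0 cx0 by (simp_all add: c_def d_def c'_def d'_def)
  obtain p q where pq: "p > 0" "q > 0" "p + q = p * c\<^sup>2 + q * d\<^sup>2"
    "\<bar>p * c + q * d\<bar> \<le> (p + q) / 2" and cd: "c \<noteq> d"
    using good_basis_weights[OF good x0 cx0] unfolding c_def d_def .
  obtain p' q' where pq': "p' > 0" "q' > 0" "p' + q' = p' * c'\<^sup>2 + q' * d'\<^sup>2"
    "\<bar>p' * c' + q' * d'\<bar> \<le> (p' + q') / 2" and cd': "c' \<noteq> d'"
    using good_basis_weights[OF good' x0 cx0] unfolding c'_def d'_def .
  obtain k :: int where k: "of_int k = c + d"
    using trace_quotient_int[OF D basis x y J] cd unfolding c_def d_def by metis
  obtain k' :: int where k': "of_int k' = c' + d'"
    using trace_quotient_int[OF D basis' x y' J] cd' unfolding c'_def d'_def by metis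
  obtain i j :: int where ij: "y' = of_int i * x + of_int j * y"
    using int_basis_coords[OF basis y'] .
  have "c' * x = (of_int i + of_int j * c) * x" using ij by (simp add: eqs algebra_simps)
  then have c': "c' = of_int i + of_int j * c" using x0 by simp
  have "quad_conj D y' = of_int i * quad_conj D x + of_int j * quad_conj D y"
    unfolding ij by (rule quad_conj_int_combination[OF D field[OF x] field[OF y]])
  then have "d' * quad_conj D x = (of_int i + of_int j * d) * quad_conj D x"
    unfolding eqs(2,4) by (simp add: algebra_simps)
  then have d': "d' = of_int i + of_int j * d" using cx0 by simp
  \<comment> \<open>The square of either determinant is the discriminant, so (c - d)^2 is the
    discriminant divided by n^2, whichever extension is chosen.\<close>
  have det: "x * quad_conj D y - y * quad_conj D x = n * (d - c)"
    "x * quad_conj D y' - y' * quad_conj D x = n * (d' - c')"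
    unfolding eqs(2,4) unfolding eqs(1,3) n_def quad_norm_def by (simp_all add: algebra_simps)
  have "n\<^sup>2 * (c' - d')\<^sup>2 = n\<^sup>2 * (c - d)\<^sup>2"
    using quad_disc_eq[OF D basis] quad_disc_eq[OF D basis']
    unfolding det by (simp add: power_mult_distrib power2_commute)
  then have W_eq: "(c' - d')\<^sup>2 = (c - d)\<^sup>2" using n0 by simp
  \<comment> \<open>The shift by \<open>i\<close> cancels, so equal squares force j^2 = 1; then
    \<open>j\<close> is odd and k' = 2 i + j k has the parity of \<open>k\<close>.\<close>
  have "c' - d' = of_int j * (c - d)" unfolding c' d' by (simp add: algebra_simps)
  then have "(of_int j)\<^sup>2 * (c - d)\<^sup>2 = 1 * (c - d)\<^sup>2"
    using W_eq by (simp add: power_mult_distrib)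
  then have "(of_int j :: real)\<^sup>2 = 1" using cd by simp
  then have "j\<^sup>2 = 1" by (metis of_int_1 of_int_eq_iff of_int_power)
  then have "odd j" by (auto simp: power2_eq_1_iff)
  moreover have "(of_int k' :: real) = of_int (2 * i + j * k)"
    unfolding k' c' d' by (simp add: k algebra_simps)
  then have "k' = 2 * i + j * k" by linarith
  ultimately have par: "even (k - k')" by simp
  define W where "W = (c - d)\<^sup>2"
  have alt: "k\<^sup>2 = k'\<^sup>2 \<or> (of_int k)\<^sup>2 + (of_int k')\<^sup>2 = 2 * (W - 3) + 2"
    using int_same_parity_near[OF par] weights_trace_bounds[OF pq k]
      weights_trace_bounds[OF pq' k'] unfolding W_eq W_def by blast
  define m m' where "m = quad_norm D y" and "m' = quad_norm D y'"
  \<comment> \<open>Here m = n c d, and 4 c d = (c + d)^2 - (c - d)^2.\<close>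
  have m: "4 * m = n * ((of_int k)\<^sup>2 - W)"
    unfolding m_def n_def quad_norm_def eqs(2) unfolding eqs(1) k W_def
    by (simp add: power2_eq_square algebra_simps)
  have m': "4 * m' = n * ((of_int k')\<^sup>2 - W)"
    unfolding m'_def n_def quad_norm_def eqs(4) unfolding eqs(3) k' W_def W_eq[symmetric]
    by (simp add: power2_eq_square algebra_simps)
  \<comment> \<open>The values of n^2 + n m + m^2 at \<open>m\<close> and \<open>m'\<close> differ
    by (m - m')(m + m' + n). Equal k^2 makes the first factor vanish, the exceptional pair of traces
    the second.\<close>
  from alt have "m = m' \<or> m + m' + n = 0"
  proof
    assume "k\<^sup>2 = k'\<^sup>2"
    then have "(of_int k :: real)\<^sup>2 = (of_int k')\<^sup>2" by (metis of_int_power)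
    then show ?thesis using m m' by simp
  next
    assume *: "(of_int k)\<^sup>2 + (of_int k')\<^sup>2 = 2 * (W - 3) + 2"
    have "4 * (m + m' + n) = n * ((of_int k)\<^sup>2 + (of_int k')\<^sup>2 - 2 * W + 4)"
      using m m' by (simp add: algebra_simps)
    then show ?thesis unfolding * by simp
  qed
  then have "(m - m') * (m + m' + n) = 0" by auto
  then have "n\<^sup>2 + n * m + m\<^sup>2 = n\<^sup>2 + n * m' + m'\<^sup>2"
    by (simp add: power2_eq_square algebra_simps)
  then show "equivalent_bases D (x, y) (x, y')"
    unfolding equivalent_bases_def basis_form_def fst_conv snd_conv
      n_def[symmetric] m_def[symmetric] m'_def[symmetric] by simp
qed

end
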